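(* Assume $\beta_x=0$ for all $x\in\Gamma$ and that $J$ with domain $\mathcal F(\Gamma)$ is not essentially selfadjoint in $\ell^2(\Gamma)$. Let $(x_n)_{n\ge0}$ be an infinite path in $\Gamma$ with $\ell(x_n)=n$ (so $x_n'=x_{n+1}$). Then the classical Jacobi matrix $J_0$ on $\ell^2(\mathbb N_0)$ given by $(J_0u)(n)=\lambda_{x_n}u(n+1)+\lambda_{x_{n-1}}u(n-1)$ (with $\lambda_{x_{-1}}u(-1):=0$), with domain the finitely supported sequences, is not essentially selfadjoint.
   Context: Let $\Gamma$ be an infinite connected tree whose vertices are arranged in levels $\ell(x)\in\{0,1,2,\dots\}$: every vertex $x$ is adjacent to exactly one vertex $x'$ with $\ell(x')=\ell(x)+1$; for $\ell(x)\ge 1$ the set $N_x=\{y:\ y'=x\}$ of neighbours of $x$ on level $\ell(x)-1$ is finite and nonempty; $N_x=\emptyset$ if $\ell(x)=0$; there are no other edges. Fix $\lambda_x>0$, $\beta_x\in\mathbb R$. The Jacobi matrix $J$ acts on functions $v:\Gamma\to\mathbb C$ by $(Jv)(x)=\lambda_x v(x')+\beta_x v(x)+\sum_{y\in N_x}\lambda_y v(y)$. $\mathcal F(\Gamma)$ denotes the finitely supported functions; $J$ with domain $\mathcal F(\Gamma)$ is symmetric in $\ell^2(\Gamma)$. *)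

theory Defs
  imports "HOL-Analysis.Analysis"
begin

definition in_l2 :: "('a \<Rightarrow> complex) \<Rightarrow> bool" where
  "in_l2 v \<longleftrightarrow> (\<lambda>x. (cmod (v x))\<^sup>2) summable_on UNIV"

definition l2_inner :: "('a \<Rightarrow> complex) \<Rightarrow> ('a \<Rightarrow> complex) \<Rightarrow> complex" where
  "l2_inner u v = (\<Sum>\<^sub>\<infinity>x. cnj (u x) * v x)"

definition l2_norm :: "('a \<Rightarrow> complex) \<Rightarrow> real" where
  "l2_norm v = sqrt (\<Sum>\<^sub>\<infinity>x. (cmod (v x))\<^sup>2)"

definition fin_supp :: "('a \<Rightarrow> complex) \<Rightarrow> bool" where
  "fin_supp v \<longleftrightarrow> finite {x. v x \<noteq> 0}"

type_synonym 'a l2graph = "(('a \<Rightarrow> complex) \<times> ('a \<Rightarrow> complex)) set"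

definition op_graph :: "('a \<Rightarrow> complex) set \<Rightarrow> (('a \<Rightarrow> complex) \<Rightarrow> ('a \<Rightarrow> complex)) \<Rightarrow> 'a l2graph" where
  "op_graph D T = {(u, T u) | u. u \<in> D}"

definition closure_op :: "'a l2graph \<Rightarrow> 'a l2graph" where
  "closure_op G = {(v, w). in_l2 v \<and> in_l2 w \<and>
     (\<exists>s. (\<forall>n. s n \<in> G) \<and>
          (\<lambda>n. l2_norm (\<lambda>x. fst (s n) x - v x)) \<longlonglongrightarrow> 0 \<and>
          (\<lambda>n. l2_norm (\<lambda>x. snd (s n) x - w x)) \<longlonglongrightarrow> 0)}"

definition adjoint_op :: "'a l2graph \<Rightarrow> 'a l2graph" where
  "adjoint_op G = {(v, w). in_l2 v \<and> in_l2 w \<and>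
     (\<forall>(u, z) \<in> G. l2_inner z v = l2_inner u w)}"

definition selfadjoint_op :: "'a l2graph \<Rightarrow> bool" where
  "selfadjoint_op G \<longleftrightarrow> adjoint_op G = G"

definition ess_selfadjoint :: "'a l2graph \<Rightarrow> bool" where
  "ess_selfadjoint G \<longleftrightarrow> selfadjoint_op (closure_op G)"

text \<open>The whole vertex type is the tree \<Gamma>; lev x is the level, up x is x'.\<close>
definition children :: "('v \<Rightarrow> 'v) \<Rightarrow> 'v \<Rightarrow> 'v set" where
  "children up x = {y. up y = x}"

definition level_tree :: "('v \<Rightarrow> nat) \<Rightarrow> ('v \<Rightarrow> 'v) \<Rightarrow> bool" where
  "level_tree lev up \<longleftrightarrow>
     (\<forall>x. lev (up x) = lev x + 1) \<and>
     (\<forall>x. lev x \<ge> 1 \<longrightarrow> finite (children up x) \<and> children up x \<noteq> {}) \<and>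
     (\<forall>x. lev x = 0 \<longrightarrow> children up x = {}) \<and>
     (\<forall>x y. \<exists>m n. (up ^^ m) x = (up ^^ n) y)"

definition jacobi_tree ::
  "('v \<Rightarrow> 'v) \<Rightarrow> ('v \<Rightarrow> real) \<Rightarrow> ('v \<Rightarrow> real) \<Rightarrow> ('v \<Rightarrow> complex) \<Rightarrow> ('v \<Rightarrow> complex)" where
  "jacobi_tree up lam beta v = (\<lambda>x. complex_of_real (lam x) * v (up x) + complex_of_real (beta x) * v x
       + (\<Sum>y\<in>children up x. complex_of_real (lam y) * v y))"

definition jacobi_classical :: "(nat \<Rightarrow> real) \<Rightarrow> (nat \<Rightarrow> complex) \<Rightarrow> (nat \<Rightarrow> complex)" where
  "jacobi_classical a u = (\<lambda>n. complex_of_real (a n) * u (Suc n)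
       + (if n = 0 then 0 else complex_of_real (a (n - 1)) * u (n - 1)))"

end

theory Submission
  imports Defs
begin

text \<open>Failure of essential selfadjointness yields a nonzero square-summable solution of \<open>J v = \<i> v\<close>.
  Since \<open>\<beta> = 0\<close>, induction on levels shows that \<open>v x' / v x\<close> is a positive multiple of \<open>\<i>\<close>, so
  \<open>\<lambda>\<^sub>x \<bar>v x'\<bar> = \<bar>v x\<bar> + \<Sum> \<lambda>\<^sub>y \<bar>v y\<bar>\<close>, the sum being over the children \<open>y\<close> of \<open>x\<close>. Along the path
  only one child is kept, so the positive solution \<open>p\<close> of
  \<open>\<lambda>\<^sub>n p (n + 1) = p n + \<lambda>\<^sub>n\<^sub>-\<^sub>1 p (n - 1)\<close> is dominated by \<open>\<bar>v\<bar>\<close>. Hence \<open>n \<mapsto> \<i>\<^sup>n p n\<close> is a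
  square-summable solution of \<open>J\<^sub>0 q = \<i> q\<close>.\<close>

section \<open>Square-summable functions\<close>

lemma l2_norm_nonneg: "0 \<le> l2_norm v"
  unfolding l2_norm_def by (intro real_sqrt_ge_zero infsum_nonneg) auto

lemma L2_set_le_l2_norm:
  assumes "in_l2 v"
  shows "L2_set (\<lambda>x. cmod (v x)) F \<le> l2_norm v"
proof (cases "finite F")
  case True
  then have "(\<Sum>x\<in>F. (cmod (v x))\<^sup>2) \<le> (\<Sum>\<^sub>\<infinity>x. (cmod (v x))\<^sup>2)"
    using assms unfolding in_l2_def by (intro finite_sum_le_infsum) auto
  then show ?thesis
    unfolding L2_set_def l2_norm_def by simp
qed (simp add: l2_norm_nonneg)

text \<open>The bridge from finite to infinite sums: inequalities for \<open>L2_set\<close> over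
  finite sets become membership in the space together with a norm bound.\<close>

lemma in_l2_boundedI:
  assumes "\<And>F. finite F \<Longrightarrow> L2_set (\<lambda>x. cmod (v x)) F \<le> C"
  shows "in_l2 v" and "l2_norm v \<le> C"
proof -
  have "0 \<le> C" using assms[of "{}"] by simp
  have *: "(\<Sum>x\<in>F. (cmod (v x))\<^sup>2) \<le> C\<^sup>2" if "finite F" for F
    using assms[OF that] unfolding L2_set_def by (rule sqrt_le_D)
  show l2: "in_l2 v"
    unfolding in_l2_def
    by (rule nonneg_bdd_above_summable_on) (auto intro!: bdd_aboveI[of _ "C\<^sup>2"] *)
  have "(\<Sum>\<^sub>\<infinity>x. (cmod (v x))\<^sup>2) \<le> C\<^sup>2"
    using l2 unfolding in_l2_def by (rule infsum_le_finite_sums) (auto intro: *)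
  then show "l2_norm v \<le> C"
    unfolding l2_norm_def using \<open>0 \<le> C\<close> by (simp add: real_le_lsqrt)
qed

lemma cmod_le_l2_norm: "in_l2 v \<Longrightarrow> cmod (v x) \<le> l2_norm v"
  using L2_set_le_l2_norm[of v "{x}"] by simp

lemma in_l2_comparison:
  assumes "in_l2 v" "\<And>x. cmod (u x) \<le> cmod (v x)"
  shows "in_l2 u"
proof -
  have "L2_set (\<lambda>x. cmod (u x)) F \<le> l2_norm v" for F
    using L2_set_mono[of F "\<lambda>x. cmod (u x)" "\<lambda>x. cmod (v x)"] assms
      L2_set_le_l2_norm[OF assms(1), of F] by fastforce
  then show ?thesis
    by (auto intro: in_l2_boundedI)
qed

lemma in_l2_add:
  assumes "in_l2 u" "in_l2 v"
  shows "in_l2 (\<lambda>x. u x + v x)" and "l2_norm (\<lambda>x. u x + v x) \<le> l2_norm u + l2_norm v"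
proof -
  have "L2_set (\<lambda>x. cmod (u x + v x)) F \<le> l2_norm u + l2_norm v" for F
  proof -
    have "L2_set (\<lambda>x. cmod (u x + v x)) F \<le> L2_set (\<lambda>x. cmod (u x) + cmod (v x)) F"
      by (rule L2_set_mono) (auto simp: norm_triangle_ineq)
    also have "\<dots> \<le> L2_set (\<lambda>x. cmod (u x)) F + L2_set (\<lambda>x. cmod (v x)) F"
      by (rule L2_set_triangle_ineq)
    also have "\<dots> \<le> l2_norm u + l2_norm v"
      using assms by (intro add_mono L2_set_le_l2_norm)
    finally show ?thesis .
  qed
  then show "in_l2 (\<lambda>x. u x + v x)" "l2_norm (\<lambda>x. u x + v x) \<le> l2_norm u + l2_norm v"
    by (auto intro: in_l2_boundedI)
qed

lemma in_l2_scale: "in_l2 v \<Longrightarrow> in_l2 (\<lambda>x. c * v x)"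
  unfolding in_l2_def norm_mult power_mult_distrib by (rule summable_on_cmult_right)

lemma l2_norm_scale: "l2_norm (\<lambda>x. c * v x) = cmod c * l2_norm v"
  unfolding l2_norm_def norm_mult power_mult_distrib infsum_cmult_right' real_sqrt_mult by simp

lemma in_l2_cnj [simp]: "in_l2 (\<lambda>x. cnj (v x)) \<longleftrightarrow> in_l2 v"
  unfolding in_l2_def by simp

lemma in_l2_minus: "in_l2 v \<Longrightarrow> in_l2 (\<lambda>x. - v x)"
  unfolding in_l2_def by simp

lemma in_l2_diff: "in_l2 u \<Longrightarrow> in_l2 v \<Longrightarrow> in_l2 (\<lambda>x. u x - v x)"
  using in_l2_add(1)[of u "\<lambda>x. - v x"] in_l2_minus[of v] by simp

lemma l2_norm_minus_commute: "l2_norm (\<lambda>x. u x - v x) = l2_norm (\<lambda>x. v x - u x)"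
  unfolding l2_norm_def by (simp add: norm_minus_commute)

lemma l2_norm_zero [simp]: "l2_norm (\<lambda>x. 0) = 0"
  unfolding l2_norm_def by simp

lemma l2_norm_eq_0D: "in_l2 v \<Longrightarrow> l2_norm v = 0 \<Longrightarrow> v x = 0"
  using cmod_le_l2_norm[of v x] by simp

lemma fin_supp_in_l2: "fin_supp u \<Longrightarrow> in_l2 u"
  unfolding fin_supp_def in_l2_def by (rule finite_nonzero_values_imp_summable_on) simp

section \<open>The inner product and its relation to the norm\<close>

lemma l2_inner_summable:
  assumes "in_l2 u" "in_l2 v"
  shows "(\<lambda>x. cmod (cnj (u x) * v x)) summable_on UNIV"
proof (rule Infinite_Sum.abs_summable_on_comparison_test')
  show "(\<lambda>x. (cmod (u x))\<^sup>2 + (cmod (v x))\<^sup>2) summable_on UNIV"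
    using assms unfolding in_l2_def by (rule summable_on_add)
  show "cmod (cnj (u x) * v x) \<le> (cmod (u x))\<^sup>2 + (cmod (v x))\<^sup>2" for x
  proof -
    have "0 \<le> cmod (u x) * cmod (v x)" by simp
    then have "cmod (u x) * cmod (v x) \<le> (cmod (u x))\<^sup>2 + (cmod (v x))\<^sup>2"
      using sum_squares_bound[of "cmod (u x)" "cmod (v x)"] by linarith
    then show ?thesis by (simp add: norm_mult)
  qed
qed

text \<open>Cauchy-Schwarz on each finite set, where it is \<open>L2_set_mult_ineq\<close>; the
  bound is uniform in the set and so survives in the infinite sum.\<close>

lemma l2_inner_bound:
  assumes "in_l2 u" "in_l2 v"
  shows "cmod (l2_inner u v) \<le> l2_norm u * l2_norm v"
proof -
  have "cmod (l2_inner u v) \<le> (\<Sum>\<^sub>\<infinity>x. cmod (cnj (u x) * v x))"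
    unfolding l2_inner_def by (rule norm_infsum_bound[OF l2_inner_summable[OF assms]])
  also have "\<dots> \<le> l2_norm u * l2_norm v"
  proof (rule infsum_le_finite_sums[OF l2_inner_summable[OF assms]])
    fix F :: "'a set"
    have "(\<Sum>x\<in>F. cmod (cnj (u x) * v x)) = (\<Sum>x\<in>F. \<bar>cmod (u x)\<bar> * \<bar>cmod (v x)\<bar>)"
      by (simp add: norm_mult)
    also have "\<dots> \<le> L2_set (\<lambda>x. cmod (u x)) F * L2_set (\<lambda>x. cmod (v x)) F"
      by (rule L2_set_mult_ineq)
    also have "\<dots> \<le> l2_norm u * l2_norm v"
      using assms by (intro mult_mono L2_set_le_l2_norm) (auto simp: l2_norm_nonneg)
    finally show "(\<Sum>x\<in>F. cmod (cnj (u x) * v x)) \<le> l2_norm u * l2_norm v" .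
  qed
  finally show ?thesis .
qed

lemma l2_inner_add_right:
  assumes "in_l2 u" "in_l2 v" "in_l2 w"
  shows "l2_inner u (\<lambda>x. v x + w x) = l2_inner u v + l2_inner u w"
  unfolding l2_inner_def distrib_left
  using assms by (intro infsum_add abs_summable_summable[OF l2_inner_summable])

lemma l2_inner_scale_right: "l2_inner u (\<lambda>x. c * v x) = c * l2_inner u v"
  unfolding l2_inner_def by (simp add: mult.left_commute infsum_cmult_right')

lemma l2_inner_commute: "l2_inner v u = cnj (l2_inner u v)"
  unfolding l2_inner_def by (simp add: mult.commute flip: infsum_cnj)

lemma l2_inner_scale_left: "l2_inner (\<lambda>x. c * u x) v = cnj c * l2_inner u v"
  unfolding l2_inner_def by (simp add: mult.assoc infsum_cmult_right')

lemma l2_inner_diff_right: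
  assumes "in_l2 u" "in_l2 v" "in_l2 w"
  shows "l2_inner u (\<lambda>x. v x - w x) = l2_inner u v - l2_inner u w"
  using l2_inner_add_right[of u v "\<lambda>x. - 1 * w x"] l2_inner_scale_right[of u "- 1" w]
    in_l2_minus[of w] assms by simp

lemma l2_inner_diff_left:
  assumes "in_l2 u" "in_l2 v" "in_l2 w"
  shows "l2_inner (\<lambda>x. u x - v x) w = l2_inner u w - l2_inner v w"
  using arg_cong[OF l2_inner_diff_right[OF assms(3,1,2)], of cnj] by (simp flip: l2_inner_commute)

lemma l2_inner_self:
  assumes "in_l2 v"
  shows "l2_inner v v = complex_of_real ((l2_norm v)\<^sup>2)"
proof -
  have "0 \<le> (\<Sum>\<^sub>\<infinity>x. (cmod (v x))\<^sup>2)" by (rule infsum_nonneg) simp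
  moreover have "l2_inner v v = (\<Sum>\<^sub>\<infinity>x. complex_of_real ((cmod (v x))\<^sup>2))"
    unfolding l2_inner_def by (simp add: mult.commute flip: complex_norm_square)
  moreover have "\<dots> = complex_of_real (\<Sum>\<^sub>\<infinity>x. (cmod (v x))\<^sup>2)"
    using has_sum_of_real[OF has_sum_infsum[OF assms[unfolded in_l2_def]]] by (rule infsumI)
  ultimately show ?thesis
    unfolding l2_norm_def by simp
qed

lemma l2_norm_add_sq:
  assumes "in_l2 u" "in_l2 v"
  shows "(l2_norm (\<lambda>x. u x + v x))\<^sup>2 = (l2_norm u)\<^sup>2 + 2 * Re (l2_inner u v) + (l2_norm v)\<^sup>2"
proof -
  let ?w = "\<lambda>x. u x + v x"
  have w: "in_l2 ?w" using assms by (rule in_l2_add)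
  have "l2_inner ?w ?w = l2_inner ?w u + l2_inner ?w v"
    using w assms by (intro l2_inner_add_right)
  also have "\<dots> = cnj (l2_inner u ?w) + cnj (l2_inner v ?w)"
    by (simp flip: l2_inner_commute)
  also have "\<dots> = cnj (l2_inner u u + l2_inner u v) + cnj (l2_inner v u + l2_inner v v)"
    using assms by (simp add: l2_inner_add_right)
  finally have "Re (l2_inner ?w ?w) = Re (l2_inner u u) + Re (l2_inner u v) + Re (l2_inner v u) + Re (l2_inner v v)"
    by simp
  moreover have "Re (l2_inner v u) = Re (l2_inner u v)"
    by (subst l2_inner_commute) simp
  ultimately show ?thesis using assms w by (simp add: l2_inner_self)
qed

lemma l2_parallelogram:
  assumes "in_l2 u" "in_l2 v"
  shows "(l2_norm (\<lambda>x. u x - v x))\<^sup>2 + (l2_norm (\<lambda>x. u x + v x))\<^sup>2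
    = 2 * (l2_norm u)\<^sup>2 + 2 * (l2_norm v)\<^sup>2"
proof -
  have "l2_inner u (\<lambda>x. - v x) = - l2_inner u v"
    using l2_inner_scale_right[of u "- 1" v] by simp
  moreover have "l2_norm (\<lambda>x. - v x) = l2_norm v"
    unfolding l2_norm_def by simp
  moreover have "(\<lambda>x. u x + - v x) = (\<lambda>x. u x - v x)" by simp
  ultimately have "(l2_norm (\<lambda>x. u x - v x))\<^sup>2
      = (l2_norm u)\<^sup>2 + 2 * - Re (l2_inner u v) + (l2_norm v)\<^sup>2"
    using l2_norm_add_sq[OF assms(1) in_l2_minus[OF assms(2)]] by (simp only: uminus_complex.sel)
  then show ?thesis
    using l2_norm_add_sq[OF assms] by linarith
qed

section \<open>Completeness and orthogonal projection\<close>

text \<open>Norm-Cauchy sequences converge pointwise. On each finite set the Cauchy bound for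
  \<open>s n - s m\<close> passes to the limit in \<open>m\<close>, and the bound so obtained is
  uniform over finite sets.\<close>

lemma l2_complete:
  assumes l2: "\<And>n. in_l2 (s n)"
    and cauchy: "\<And>e. 0 < e \<Longrightarrow> \<exists>N. \<forall>m\<ge>N. \<forall>n\<ge>N. l2_norm (\<lambda>x. s m x - s n x) < e"
  shows "\<exists>p. in_l2 p \<and> (\<lambda>n. l2_norm (\<lambda>x. s n x - p x)) \<longlonglongrightarrow> 0"
proof -
  define p where "p x = lim (\<lambda>n. s n x)" for x
  have "Cauchy (\<lambda>n. s n x)" for x
  proof (rule CauchyI)
    fix e :: real assume "0 < e"
    then obtain N where N: "\<forall>m\<ge>N. \<forall>n\<ge>N. l2_norm (\<lambda>x. s m x - s n x) < e"
      using cauchy by blast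
    have "norm (s m x - s n x) \<le> l2_norm (\<lambda>x. s m x - s n x)" for m n
      using cmod_le_l2_norm[OF in_l2_diff[OF l2 l2]] .
    then show "\<exists>N. \<forall>m\<ge>N. \<forall>n\<ge>N. norm (s m x - s n x) < e"
      using N by (meson le_less_trans)
  qed
  then have p: "(\<lambda>n. s n x) \<longlonglongrightarrow> p x" for x
    unfolding p_def by (simp add: Cauchy_convergent_iff convergent_LIMSEQ_iff)
  have tail: "\<exists>N. \<forall>n\<ge>N. in_l2 (\<lambda>x. s n x - p x) \<and> l2_norm (\<lambda>x. s n x - p x) \<le> e" if e: "0 < e" for e
  proof -
    obtain N where N: "\<And>m n. m \<ge> N \<Longrightarrow> n \<ge> N \<Longrightarrow> l2_norm (\<lambda>x. s m x - s n x) < e"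
      using cauchy[OF e] by blast
    have "L2_set (\<lambda>x. cmod (s n x - p x)) F \<le> e" if n: "n \<ge> N" for n F
    proof (rule tendsto_upperbound[OF _ eventually_sequentiallyI trivial_limit_sequentially])
      show "(\<lambda>m. L2_set (\<lambda>x. cmod (s n x - s m x)) F) \<longlonglongrightarrow> L2_set (\<lambda>x. cmod (s n x - p x)) F"
        unfolding L2_set_def by (intro tendsto_intros p)
      show "L2_set (\<lambda>x. cmod (s n x - s m x)) F \<le> e" if "m \<ge> N" for m
        using L2_set_le_l2_norm[OF in_l2_diff[OF l2[of n] l2[of m]], of F] N[OF n that] by linarith
    qed
    then show ?thesis
      using in_l2_boundedI[of "\<lambda>x. s _ x - p x" e] by (intro exI[of _ N] allI impI conjI) auto
  qed
  have "in_l2 p"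
  proof -
    obtain n where "in_l2 (\<lambda>x. s n x - p x)" using tail[OF zero_less_one] by blast
    from in_l2_diff[OF l2[of n] this] show ?thesis by simp
  qed
  moreover have "(\<lambda>n. l2_norm (\<lambda>x. s n x - p x)) \<longlonglongrightarrow> 0"
  proof (rule LIMSEQ_I)
    fix e :: real assume "0 < e"
    then obtain N where N: "\<forall>n\<ge>N. l2_norm (\<lambda>x. s n x - p x) \<le> e/2"
      using tail[OF half_gt_zero] by blast
    have "l2_norm (\<lambda>x. s n x - p x) < e" if "n \<ge> N" for n
      using N[rule_format, OF that] \<open>0 < e\<close> by linarith
    then show "\<exists>N. \<forall>n\<ge>N. norm (l2_norm (\<lambda>x. s n x - p x) - 0) < e"
      by (intro exI[of _ N]) (simp add: l2_norm_nonneg)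
  qed
  ultimately show ?thesis by blast
qed

lemma l2_norm_triangle_sub:
  assumes "in_l2 u" "in_l2 v"
  shows "l2_norm u \<le> l2_norm v + l2_norm (\<lambda>x. u x - v x)"
  using in_l2_add(2)[OF assms(2) in_l2_diff[OF assms]] by simp

lemma tendsto_l2_norm:
  assumes "\<And>n. in_l2 (s n)" "in_l2 p" "(\<lambda>n. l2_norm (\<lambda>x. s n x - p x)) \<longlonglongrightarrow> 0"
  shows "(\<lambda>n. l2_norm (s n)) \<longlonglongrightarrow> l2_norm p"
proof (rule LIM_zero_cancel, rule Lim_null_comparison[OF _ assms(3)], rule always_eventually, rule allI)
  fix n
  show "norm (l2_norm (s n) - l2_norm p) \<le> l2_norm (\<lambda>x. s n x - p x)"
    using l2_norm_triangle_sub[OF assms(1)[of n] assms(2)] l2_norm_triangle_sub[OF assms(2) assms(1)[of n]]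
      l2_norm_minus_commute[of "s n" p] by simp
qed

lemma tendsto_l2_inner_left:
  assumes "\<And>n. in_l2 (s n)" "in_l2 p" "in_l2 v" "(\<lambda>n. l2_norm (\<lambda>x. s n x - p x)) \<longlonglongrightarrow> 0"
  shows "(\<lambda>n. l2_inner (s n) v) \<longlonglongrightarrow> l2_inner p v"
proof (rule LIM_zero_cancel, rule Lim_null_comparison)
  show "\<forall>\<^sub>F n in sequentially. norm (l2_inner (s n) v - l2_inner p v) \<le> l2_norm (\<lambda>x. s n x - p x) * l2_norm v"
    using l2_inner_bound[OF in_l2_diff[OF assms(1,2)] assms(3)] assms(1-3)
    by (simp add: l2_inner_diff_left)
  show "(\<lambda>n. l2_norm (\<lambda>x. s n x - p x) * l2_norm v) \<longlonglongrightarrow> 0"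
    using tendsto_mult_left_zero[OF assms(4)] .
qed

text \<open>A minimizing sequence for the distance from \<open>v\<close> to \<open>P\<close> is
  Cauchy by the parallelogram law. \<open>P\<close> is a subspace that may fail to be closed, hence
  the sequence \<open>s\<close> in \<open>P\<close> is returned along with its limit
  \<open>p\<close>.\<close>

lemma l2_orthogonal_projection:
  assumes P: "P \<noteq> {}" "\<And>u. u \<in> P \<Longrightarrow> in_l2 u"
    and lin: "\<And>a b u w. u \<in> P \<Longrightarrow> w \<in> P \<Longrightarrow> (\<lambda>x. a * u x + b * w x) \<in> P"
    and v: "in_l2 v"
  shows "\<exists>p s. in_l2 p \<and> (\<forall>n. s n \<in> P) \<and> (\<lambda>n. l2_norm (\<lambda>x. s n x - p x)) \<longlonglongrightarrow> 0 \<and>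
    (\<forall>u\<in>P. l2_inner u (\<lambda>x. v x - p x) = 0)"
proof -
  define d where "d = (INF u\<in>P. (l2_norm (\<lambda>x. v x - u x))\<^sup>2)"
  have bdd: "bdd_below ((\<lambda>u. (l2_norm (\<lambda>x. v x - u x))\<^sup>2) ` P)"
    by (rule bdd_belowI[of _ 0]) auto
  have d_le: "d \<le> (l2_norm (\<lambda>x. v x - u x))\<^sup>2" if "u \<in> P" for u
    unfolding d_def by (rule cINF_lower[OF bdd that])
  have "\<exists>u\<in>P. (l2_norm (\<lambda>x. v x - u x))\<^sup>2 < d + inverse (Suc n)" for n
    using cINF_less_iff[OF P(1) bdd, of "d + inverse (Suc n)"] by (simp add: d_def)
  then obtain s where s: "\<And>n. s n \<in> P" "\<And>n. (l2_norm (\<lambda>x. v x - s n x))\<^sup>2 < d + inverse (Suc n)"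
    by metis
  have sl2: "in_l2 (s n)" for n using P(2) s(1) .
  have dist: "(l2_norm (\<lambda>x. s m x - s n x))\<^sup>2 \<le> 2 * inverse (Suc m) + 2 * inverse (Suc n)" for m n
  proof -
    \<comment> \<open>The midpoint stays in \<open>P\<close>, so its distance to \<open>v\<close> is
      bounded below by \<open>d\<close>; the parallelogram law then forces \<open>s m\<close> and
      \<open>s n\<close> together.\<close>
    let ?q = "\<lambda>x. 1/2 * s m x + 1/2 * s n x"
    have "(\<lambda>x. (v x - s m x) + (v x - s n x)) = (\<lambda>x. 2 * (v x - ?q x))" by auto
    then have "(l2_norm (\<lambda>x. (v x - s m x) + (v x - s n x)))\<^sup>2 = 4 * (l2_norm (\<lambda>x. v x - ?q x))\<^sup>2"
      by (simp only: l2_norm_scale) (simp add: power_mult_distrib)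
    moreover have "(\<lambda>x. (v x - s m x) - (v x - s n x)) = (\<lambda>x. s n x - s m x)" by auto
    moreover have "d \<le> (l2_norm (\<lambda>x. v x - ?q x))\<^sup>2"
      by (rule d_le[OF lin[OF s(1) s(1)]])
    ultimately show ?thesis
      using l2_parallelogram[OF in_l2_diff[OF v sl2[of m]] in_l2_diff[OF v sl2[of n]]]
        s(2)[of m] s(2)[of n] l2_norm_minus_commute[of "s m" "s n"] by simp
  qed
  have "\<exists>N. \<forall>m\<ge>N. \<forall>n\<ge>N. l2_norm (\<lambda>x. s m x - s n x) < e" if e: "0 < e" for e
  proof -
    obtain N where N: "inverse (real (Suc N)) < e\<^sup>2 / 4"
      using reals_Archimedean[of "e\<^sup>2 / 4"] e by auto
    have "l2_norm (\<lambda>x. s m x - s n x) < e" if "m \<ge> N" "n \<ge> N" for m n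
    proof -
      have "inverse (real (Suc m)) \<le> inverse (real (Suc N))" "inverse (real (Suc n)) \<le> inverse (real (Suc N))"
        using that by (simp_all add: le_imp_inverse_le)
      then have "(l2_norm (\<lambda>x. s m x - s n x))\<^sup>2 < e\<^sup>2"
        using dist[of m n] N by linarith
      then show ?thesis using e by (simp add: power_less_imp_less_base)
    qed
    then show ?thesis by blast
  qed
  from l2_complete[OF sl2 this] obtain p
    where p: "in_l2 p" "(\<lambda>n. l2_norm (\<lambda>x. s n x - p x)) \<longlonglongrightarrow> 0" by blast
  let ?r = "\<lambda>x. v x - p x"
  have r: "in_l2 ?r" using v p(1) by (rule in_l2_diff)
  \<comment> \<open>\<open>p\<close> may lie outside \<open>P\<close>, so minimality is applied to
    \<open>s n\<close> and carried over to \<open>p\<close> by this limit.\<close>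
  have lim: "(\<lambda>n. (l2_norm (\<lambda>x. (v x - s n x) + w x))\<^sup>2) \<longlonglongrightarrow> (l2_norm (\<lambda>x. ?r x + w x))\<^sup>2"
    if w: "in_l2 w" for w
  proof (intro tendsto_power tendsto_l2_norm)
    have "(\<lambda>x. (v x - s n x + w x) - (?r x + w x)) = (\<lambda>x. p x - s n x)" for n by auto
    then show "(\<lambda>n. l2_norm (\<lambda>x. (v x - s n x + w x) - (?r x + w x))) \<longlonglongrightarrow> 0"
      using p(2) by (simp add: l2_norm_minus_commute[of p])
  qed (auto intro!: in_l2_add in_l2_diff v sl2 p w)
  have r_le: "(l2_norm ?r)\<^sup>2 \<le> d"
  proof (rule LIMSEQ_le)
    show "(\<lambda>n. (l2_norm (\<lambda>x. v x - s n x))\<^sup>2) \<longlonglongrightarrow> (l2_norm ?r)\<^sup>2"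
      using lim[of "\<lambda>x. 0"] by (simp add: in_l2_def)
    show "(\<lambda>n. d + inverse (real (Suc n))) \<longlonglongrightarrow> d"
      using LIMSEQ_inverse_real_of_nat_add .
    show "\<exists>N. \<forall>n\<ge>N. (l2_norm (\<lambda>x. v x - s n x))\<^sup>2 \<le> d + inverse (real (Suc n))"
      using s(2) less_imp_le by blast
  qed
  have "l2_inner u ?r = 0" if u: "u \<in> P" for u
  proof -
    define c where "c = l2_inner u ?r"
    define K where "K = (l2_norm u)\<^sup>2"
    have ul2: "in_l2 u" using P(2) u .
    have le: "2 * t * (cmod c)\<^sup>2 \<le> t\<^sup>2 * (cmod c)\<^sup>2 * K" for t :: real
    proof -
      \<comment> \<open>Moving along \<open>z * u\<close> changes the squared norm of the residual
        to first order by \<open>- 2 * t * (cmod c)\<^sup>2\<close>, a decrease for positive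
        \<open>t\<close> unless \<open>c = 0\<close>.\<close>
      define z where "z = - complex_of_real t * c"
      have "d \<le> (l2_norm (\<lambda>x. (v x - s n x) + z * u x))\<^sup>2" for n
        using d_le[OF lin[OF s(1)[of n] u, of 1 "-z"]] by (simp add: algebra_simps)
      then have "d \<le> (l2_norm (\<lambda>x. ?r x + z * u x))\<^sup>2"
        using LIMSEQ_le_const[OF lim[OF in_l2_scale[OF ul2, of z]]] by blast
      then have "0 \<le> 2 * Re (l2_inner ?r (\<lambda>x. z * u x)) + (l2_norm (\<lambda>x. z * u x))\<^sup>2"
        using l2_norm_add_sq[OF r in_l2_scale[OF ul2, of z]] r_le by linarith
      also have "l2_inner ?r (\<lambda>x. z * u x) = z * cnj c"
        unfolding c_def by (simp add: l2_inner_scale_right flip: l2_inner_commute)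
      also have "z * cnj c = complex_of_real (- t * (cmod c)\<^sup>2)"
        unfolding z_def by (simp add: mult.assoc flip: complex_norm_square)
      also have "(l2_norm (\<lambda>x. z * u x))\<^sup>2 = t\<^sup>2 * (cmod c)\<^sup>2 * K"
        unfolding K_def l2_norm_scale by (simp add: z_def norm_mult power_mult_distrib)
      finally show ?thesis by simp
    qed
    \<comment> \<open>Small enough that the quadratic term cannot compensate the linear one; the
      added 1 covers \<open>K = 0\<close>.\<close>
    define t where "t = 1 / (K + 1)"
    have "0 \<le> K" unfolding K_def by simp
    then have t: "0 < t" "t * K \<le> 1" unfolding t_def by auto
    have "2 * (t * (cmod c)\<^sup>2) \<le> (t * K) * (t * (cmod c)\<^sup>2)"
      using le[of t] by (simp add: power2_eq_square ac_simps)
    also have "\<dots> \<le> 1 * (t * (cmod c)\<^sup>2)"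
      using t by (intro mult_right_mono) auto
    finally have "t * (cmod c)\<^sup>2 \<le> 0" by simp
    then have "(cmod c)\<^sup>2 \<le> 0" using t(1) by (simp add: mult_le_0_iff)
    then show ?thesis unfolding c_def by simp
  qed
  then show ?thesis using p s(1) by blast
qed

section \<open>Direct sums, encoded by functions on a sum type\<close>

lemma
  fixes h k :: "'a + 'b \<Rightarrow> complex"
  shows in_l2_sum_iff: "in_l2 h \<longleftrightarrow> in_l2 (\<lambda>x. h (Inl x)) \<and> in_l2 (\<lambda>x. h (Inr x))"
    and l2_inner_sum: "in_l2 h \<Longrightarrow> in_l2 k \<Longrightarrow> l2_inner h k
      = l2_inner (\<lambda>x. h (Inl x)) (\<lambda>x. k (Inl x)) + l2_inner (\<lambda>x. h (Inr x)) (\<lambda>x. k (Inr x))"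
proof -
  have un: "UNIV = range Inl \<union> (range Inr :: ('a + 'b) set)" and disj: "range Inl \<inter> (range Inr :: ('a + 'b) set) = {}"
    by (rule UNIV_sum) auto
  have "(\<lambda>x. (cmod (h x))\<^sup>2) summable_on UNIV \<longleftrightarrow>
      (\<lambda>x. (cmod (h x))\<^sup>2) summable_on range Inl \<and> (\<lambda>x. (cmod (h x))\<^sup>2) summable_on range Inr"
    unfolding un by (meson summable_on_Un_disjoint[OF _ _ disj] summable_on_subset_banach Un_upper1 Un_upper2)
  then show "in_l2 h \<longleftrightarrow> in_l2 (\<lambda>x. h (Inl x)) \<and> in_l2 (\<lambda>x. h (Inr x))"
    unfolding in_l2_def by (simp add: summable_on_reindex o_def)
  assume "in_l2 h" "in_l2 k"
  then have "(\<lambda>x. cnj (h x) * k x) summable_on UNIV"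
    by (intro abs_summable_summable[OF l2_inner_summable])
  then have "(\<lambda>x. cnj (h x) * k x) summable_on A" for A
    by (rule summable_on_subset_banach) simp
  then show "l2_inner h k
      = l2_inner (\<lambda>x. h (Inl x)) (\<lambda>x. k (Inl x)) + l2_inner (\<lambda>x. h (Inr x)) (\<lambda>x. k (Inr x))"
    unfolding l2_inner_def un by (subst infsum_Un_disjoint[OF _ _ disj]) (simp_all add: infsum_reindex o_def)
qed

text \<open>By Pythagoras in the direct sum. Convergence of pairs thus gives convergence of both
  components.\<close>

lemma l2_norm_sum_ge:
  fixes h :: "'a + 'b \<Rightarrow> complex"
  assumes "in_l2 h"
  shows "l2_norm (\<lambda>x. h (Inl x)) \<le> l2_norm h" and "l2_norm (\<lambda>x. h (Inr x)) \<le> l2_norm h"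
proof -
  have "complex_of_real ((l2_norm h)\<^sup>2)
      = complex_of_real ((l2_norm (\<lambda>x. h (Inl x)))\<^sup>2 + (l2_norm (\<lambda>x. h (Inr x)))\<^sup>2)"
    using l2_inner_sum[OF assms assms] assms by (simp add: l2_inner_self in_l2_sum_iff)
  then have "(l2_norm h)\<^sup>2 = (l2_norm (\<lambda>x. h (Inl x)))\<^sup>2 + (l2_norm (\<lambda>x. h (Inr x)))\<^sup>2"
    by (simp only: of_real_eq_iff)
  then show "l2_norm (\<lambda>x. h (Inl x)) \<le> l2_norm h" "l2_norm (\<lambda>x. h (Inr x)) \<le> l2_norm h"
    by (rule_tac power2_le_imp_le[OF _ l2_norm_nonneg], simp)+
qed

section \<open>Closures, adjoints and deficiency spaces\<close>

lemma subset_closure_op: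
  assumes "\<And>u z. (u, z) \<in> G \<Longrightarrow> in_l2 u \<and> in_l2 z"
  shows "G \<subseteq> closure_op G"
proof clarify
  fix u z assume "(u, z) \<in> G"
  then show "(u, z) \<in> closure_op G"
    unfolding closure_op_def using assms by (auto intro!: exI[of _ "\<lambda>_. (u, z)"])
qed

lemma adjoint_op_antimono:
  assumes "G \<subseteq> H"
  shows "adjoint_op H \<subseteq> adjoint_op G"
proof clarify
  fix v w assume "(v, w) \<in> adjoint_op H"
  then show "(v, w) \<in> adjoint_op G"
    using assms unfolding adjoint_op_def by auto
qed

text \<open>The defining identity of the adjoint is continuous in the pair \<open>(u, z)\<close>, so
  it extends from \<open>G\<close> to limits of its elements.\<close>

lemma adjoint_closure_op:
  assumes l2: "\<And>u z. (u, z) \<in> G \<Longrightarrow> in_l2 u \<and> in_l2 z"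
  shows "adjoint_op (closure_op G) = adjoint_op G"
proof
  show "adjoint_op (closure_op G) \<subseteq> adjoint_op G"
    by (rule adjoint_op_antimono[OF subset_closure_op[OF l2]])
  show "adjoint_op G \<subseteq> adjoint_op (closure_op G)"
  proof clarify
    fix v w assume "(v, w) \<in> adjoint_op G"
    then have vw: "in_l2 v" "in_l2 w" "\<And>u z. (u, z) \<in> G \<Longrightarrow> l2_inner z v = l2_inner u w"
      unfolding adjoint_op_def by auto
    have "l2_inner z v = l2_inner u w" if "(u, z) \<in> closure_op G" for u z
    proof -
      from that obtain s where uz: "in_l2 u" "in_l2 z" and s: "\<And>n. s n \<in> G"
        "(\<lambda>n. l2_norm (\<lambda>x. fst (s n) x - u x)) \<longlonglongrightarrow> 0"
        "(\<lambda>n. l2_norm (\<lambda>x. snd (s n) x - z x)) \<longlonglongrightarrow> 0"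
        unfolding closure_op_def by auto
      have sl2: "in_l2 (fst (s n))" "in_l2 (snd (s n))" for n
        using l2[of "fst (s n)" "snd (s n)"] s(1)[of n] by auto
      have "(\<lambda>n. l2_inner (fst (s n)) w) \<longlonglongrightarrow> l2_inner u w"
        by (rule tendsto_l2_inner_left[OF sl2(1) uz(1) vw(2) s(2)])
      moreover have "l2_inner (fst (s n)) w = l2_inner (snd (s n)) v" for n
        using vw(3)[of "fst (s n)" "snd (s n)"] s(1)[of n] by simp
      moreover have "(\<lambda>n. l2_inner (snd (s n)) v) \<longlonglongrightarrow> l2_inner z v"
        by (rule tendsto_l2_inner_left[OF sl2(2) uz(2) vw(1) s(3)])
      ultimately show ?thesis using LIMSEQ_unique by auto
    qed
    then show "(v, w) \<in> adjoint_op (closure_op G)"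
      using vw(1,2) unfolding adjoint_op_def by auto
  qed
qed

section \<open>Finite sums over the tree and test functions\<close>

lemma l2_inner_finite:
  assumes "finite T" "\<And>x. x \<notin> T \<Longrightarrow> u x = 0"
  shows "l2_inner u v = (\<Sum>x\<in>T. cnj (u x) * v x)"
  unfolding l2_inner_def using assms by (intro infsumI has_sum_finite_neutralI) auto

text \<open>The sets of children are disjoint, since \<open>y\<close> is a child of
  \<open>up y\<close> only. The last assumption keeps the support of \<open>f\<close> inside both
  index sets.\<close>

lemma sum_children:
  fixes f :: "'v \<Rightarrow> complex"
  assumes "\<And>x. finite (children up x)" "finite A" "finite B"
    and "\<And>y. f y \<noteq> 0 \<Longrightarrow> up y \<in> A \<and> y \<in> B"
  shows "(\<Sum>x\<in>A. \<Sum>y\<in>children up x. f y) = (\<Sum>y\<in>B. f y)"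
proof -
  have "(\<Sum>x\<in>A. \<Sum>y\<in>children up x. f y) = sum f (\<Union>x\<in>A. children up x)"
    using assms by (intro sum.UNION_disjoint[symmetric]) (auto simp: children_def)
  also have "\<dots> = sum f B"
    using assms by (intro sum.mono_neutral_cong) (auto simp: children_def)
  finally show ?thesis .
qed

text \<open>Testing with unit vectors. No summability enters, which allows later use with
  \<open>J v\<close> for arbitrary \<open>v\<close>.\<close>

lemma orthogonal_fin_suppD:
  fixes v w :: "'a \<Rightarrow> complex"
  assumes "\<And>u. fin_supp u \<Longrightarrow> l2_inner u v = l2_inner u w"
  shows "v = w"
proof
  fix a :: 'a
  let ?d = "\<lambda>x. if x = a then 1 else 0 :: complex"
  have "l2_inner ?d f = f a" for f
    by (subst l2_inner_finite[of "{a}"]) auto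
  moreover have "fin_supp ?d" unfolding fin_supp_def by simp
  ultimately show "v a = w a" using assms by metis
qed

text \<open>Phrased for a parent map with finite fibres, so that the results apply both to the tree
  and, with \<open>up = Suc\<close>, to the half-line.\<close>

context
  fixes up :: "'v \<Rightarrow> 'v" and lam beta :: "'v \<Rightarrow> real"
  assumes fin_children: "\<And>x. finite (children up x)"
begin

private abbreviation (input) "J \<equiv> jacobi_tree up lam beta"
private abbreviation (input) "G \<equiv> op_graph {v. fin_supp v} J"

lemma J_lin: "J (\<lambda>x. a * u x + b * w x) = (\<lambda>x. a * J u x + b * J w x)"
  unfolding jacobi_tree_def
  by (simp add: algebra_simps sum.distrib sum_distrib_left)

lemma J_cnj: "J (\<lambda>x. cnj (u x)) = (\<lambda>x. cnj (J u x))"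
  unfolding jacobi_tree_def by simp

text \<open>Summation by parts: each edge contributes once upwards and once downwards with the same
  real weight. Only \<open>u\<close> has finite support; \<open>v\<close> is an arbitrary
  function.\<close>

lemma fin_supp_and_J_symmetric:
  assumes "fin_supp u"
  shows fin_supp_J: "fin_supp (J u)"
    and J_symmetric: "l2_inner (J u) v = l2_inner u (J v)"
proof -
  define S where "S = {x. u x \<noteq> 0}"
  \<comment> \<open>The support together with all its neighbours, a finite set outside which both
    \<open>u\<close> and \<open>J u\<close> vanish.\<close>
  define T where "T = S \<union> (\<Union>a\<in>S. children up a) \<union> up ` S"
  have S: "finite S" using assms unfolding fin_supp_def S_def .
  then have T: "finite T" unfolding T_def using fin_children by auto
  have uT: "u x = 0" if "x \<notin> T" for x using that unfolding T_def S_def by auto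
  have JT: "J u x = 0" if "x \<notin> T" for x
  proof -
    have "u (up x) = 0" "u x = 0" "\<And>y. y \<in> children up x \<Longrightarrow> u y = 0"
      using that unfolding T_def S_def children_def by auto
    then show ?thesis unfolding jacobi_tree_def by simp
  qed
  then have "{x. J u x \<noteq> 0} \<subseteq> T" by auto
  then show "fin_supp (J u)" unfolding fin_supp_def using T finite_subset by blast
  \<comment> \<open>Here and in \<open>up\<close>, edges are indexed by their lower endpoint; this
    exchanges sums over children with sums over parents.\<close>
  have down: "(\<Sum>x\<in>T. \<Sum>y\<in>children up x. lam y * cnj (u (up y)) * v y) = (\<Sum>y\<in>T. lam y * cnj (u (up y)) * v y)"
    using fin_children T by (rule sum_children[OF _ _ T]) (auto simp: T_def S_def children_def)
  have up: "(\<Sum>x\<in>T. \<Sum>y\<in>children up x. lam y * cnj (u y) * v (up y)) = (\<Sum>y\<in>T. lam y * cnj (u y) * v (up y))"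
    using fin_children T by (rule sum_children[OF _ _ T]) (auto simp: T_def S_def children_def)
  have "l2_inner (J u) v = (\<Sum>x\<in>T. cnj (J u x) * v x)"
    using T JT by (rule l2_inner_finite)
  also have "\<dots> = (\<Sum>x\<in>T. lam x * cnj (u (up x)) * v x) + (\<Sum>x\<in>T. beta x * cnj (u x) * v x)
      + (\<Sum>x\<in>T. \<Sum>y\<in>children up x. lam y * cnj (u y) * v x)"
    unfolding jacobi_tree_def by (simp add: sum.distrib distrib_right sum_distrib_right)
  also have "(\<Sum>x\<in>T. \<Sum>y\<in>children up x. lam y * cnj (u y) * v x)
      = (\<Sum>x\<in>T. \<Sum>y\<in>children up x. lam y * cnj (u y) * v (up y))"
    by (intro sum.cong) (auto simp: children_def)
  also note up
  also note down[symmetric]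
  also have "(\<Sum>x\<in>T. \<Sum>y\<in>children up x. lam y * cnj (u (up y)) * v y)
      = (\<Sum>x\<in>T. \<Sum>y\<in>children up x. lam y * cnj (u x) * v y)"
    by (intro sum.cong) (auto simp: children_def)
  also have "(\<Sum>x\<in>T. \<Sum>y\<in>children up x. lam y * cnj (u x) * v y) + (\<Sum>x\<in>T. beta x * cnj (u x) * v x)
      + (\<Sum>y\<in>T. lam y * cnj (u y) * v (up y)) = (\<Sum>x\<in>T. cnj (u x) * J v x)"
    unfolding jacobi_tree_def
    by (simp add: sum.distrib distrib_left sum_distrib_left mult.left_commute mult.assoc)
  also have "\<dots> = l2_inner u (J v)"
    using T uT by (rule l2_inner_finite[symmetric])
  finally show "l2_inner (J u) v = l2_inner u (J v)" .
qed

lemma G_in_l2: "(u, z) \<in> G \<Longrightarrow> in_l2 u \<and> in_l2 z"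
  unfolding op_graph_def using fin_supp_in_l2 fin_supp_J by auto

text \<open>The adjoint is the maximal operator: symmetry moves \<open>J\<close> onto
  \<open>v\<close>, and unit vectors then identify \<open>w\<close> with \<open>J v\<close>
  pointwise.\<close>

lemma adjoint_op_G: "(v, w) \<in> adjoint_op G \<longleftrightarrow> in_l2 v \<and> in_l2 w \<and> w = J v"
proof -
  have "(v, w) \<in> adjoint_op G \<longleftrightarrow> in_l2 v \<and> in_l2 w \<and> (\<forall>u. fin_supp u \<longrightarrow> l2_inner (J u) v = l2_inner u w)"
    unfolding adjoint_op_def op_graph_def by auto
  then show ?thesis
    using orthogonal_fin_suppD[of "J v" w] J_symmetric[of _ v] by metis
qed

text \<open>Norm convergence implies pointwise convergence, and \<open>J\<close> involves finitely
  many values at each vertex, so it respects pointwise limits.\<close>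

lemma closure_op_G_le: "closure_op G \<subseteq> adjoint_op G"
proof clarify
  fix v w assume "(v, w) \<in> closure_op G"
  then obtain s where vw: "in_l2 v" "in_l2 w" and s: "\<And>n. s n \<in> G"
    "(\<lambda>n. l2_norm (\<lambda>x. fst (s n) x - v x)) \<longlonglongrightarrow> 0"
    "(\<lambda>n. l2_norm (\<lambda>x. snd (s n) x - w x)) \<longlonglongrightarrow> 0"
    unfolding closure_op_def by auto
  have sl2: "in_l2 (fst (s n))" "in_l2 (snd (s n))" for n
    using G_in_l2[of "fst (s n)" "snd (s n)"] s(1)[of n] by auto
  have pt: "(\<lambda>n. f n x) \<longlonglongrightarrow> g x"
    if "\<And>n. in_l2 (f n)" "in_l2 g" "(\<lambda>n. l2_norm (\<lambda>x. f n x - g x)) \<longlonglongrightarrow> 0"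
    for f and g :: "'v \<Rightarrow> complex" and x
    using that by (intro LIM_zero_cancel[OF Lim_null_comparison[OF _ that(3)]])
      (auto intro!: always_eventually cmod_le_l2_norm[of "\<lambda>x. f _ x - g x"] in_l2_diff)
  have "w x = J v x" for x
  proof (rule LIMSEQ_unique)
    show "(\<lambda>n. snd (s n) x) \<longlonglongrightarrow> w x" by (rule pt[OF sl2(2) vw(2) s(3)])
    have "snd (s n) = J (fst (s n))" for n using s(1)[of n] unfolding op_graph_def by auto
    moreover have "(\<lambda>n. J (fst (s n)) x) \<longlonglongrightarrow> J v x"
      unfolding jacobi_tree_def by (intro tendsto_intros pt[OF sl2(1) vw(1) s(2)])
    ultimately show "(\<lambda>n. snd (s n) x) \<longlonglongrightarrow> J v x" by simp
  qed
  then show "(v, w) \<in> adjoint_op G"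
    using vw adjoint_op_G by auto
qed

lemma ess_selfadjoint_G_iff: "ess_selfadjoint G \<longleftrightarrow> adjoint_op G \<subseteq> closure_op G"
  unfolding ess_selfadjoint_def selfadjoint_op_def
  using adjoint_closure_op[of G, OF G_in_l2] closure_op_G_le by blast

text \<open>The residual of the orthogonal projection onto the operator graph, inside
  \<open>\<ell>\<^sup>2 \<oplus> \<ell>\<^sup>2\<close>, is a pair \<open>(v, J v)\<close> with \<open>J (J v) = - v\<close>; then \<open>J v + \<i> v\<close> lies in a deficiency space.\<close>

lemma ess_selfadjoint_if_no_deficiency:
  assumes no_def: "\<And>v. in_l2 v \<Longrightarrow> J v = (\<lambda>x. \<i> * v x) \<Longrightarrow> v = (\<lambda>x. 0)"
  shows "ess_selfadjoint G"
  unfolding ess_selfadjoint_G_iff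
proof clarify
  fix v f assume "(v, f) \<in> adjoint_op G"
  then have v: "in_l2 v" "in_l2 f" "f = J v" unfolding adjoint_op_G by auto
  \<comment> \<open>The graph of \<open>J\<close> on finitely supported functions, each pair coded
    as one function on the sum type.\<close>
  define P where "P = (\<lambda>u. case_sum u (J u)) ` {u. fin_supp u}"
  have Pl2: "in_l2 h" if "h \<in> P" for h
    using that unfolding P_def
    by (auto simp: in_l2_sum_iff intro: fin_supp_in_l2 fin_supp_in_l2[OF fin_supp_J])
  have fin_lin: "fin_supp (\<lambda>x. a * u x + b * w x)" if "fin_supp u" "fin_supp w" for a b u w
  proof -
    have "{x. a * u x + b * w x \<noteq> 0} \<subseteq> {x. u x \<noteq> 0} \<union> {x. w x \<noteq> 0}" by auto
    then show ?thesis using that unfolding fin_supp_def by (meson finite_Un finite_subset)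
  qed
  have lin: "(\<lambda>x. a * h x + b * k x) \<in> P" if hk: "h \<in> P" "k \<in> P" for a b h k
  proof -
    obtain u w where uw: "fin_supp u" "fin_supp w" "h = case_sum u (J u)" "k = case_sum w (J w)"
      using hk unfolding P_def by blast
    have "(\<lambda>x. a * h x + b * k x) = case_sum (\<lambda>x. a * u x + b * w x) (J (\<lambda>x. a * u x + b * w x))"
      unfolding J_lin uw by (auto split: sum.split)
    then show ?thesis unfolding P_def using fin_lin[OF uw(1,2)] by blast
  qed
  have "case_sum (\<lambda>x. 0) (J (\<lambda>x. 0)) \<in> P" unfolding P_def fin_supp_def by auto
  then have "P \<noteq> {}" by blast
  moreover have "in_l2 (case_sum v f)" using v by (simp add: in_l2_sum_iff)
  ultimately obtain p s where p: "in_l2 p" "\<And>n. s n \<in> P" "(\<lambda>n. l2_norm (\<lambda>x. s n x - p x)) \<longlonglongrightarrow> 0"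
    and orth: "\<And>h. h \<in> P \<Longrightarrow> l2_inner h (\<lambda>x. case_sum v f x - p x) = 0"
    using l2_orthogonal_projection[of P "case_sum v f", OF _ Pl2 lin] by blast
  define a b where "a x = p (Inl x)" and "b x = p (Inr x)" for x
  have ab: "in_l2 a" "in_l2 b" using p(1) unfolding in_l2_sum_iff a_def b_def by auto
  have cl: "(a, b) \<in> closure_op G"
  proof -
    have "\<exists>u. fin_supp u \<and> s n = case_sum u (J u)" for n using p(2)[of n] unfolding P_def by auto
    then obtain u where u: "\<And>n. fin_supp (u n)" "\<And>n. s n = case_sum (u n) (J (u n))" by metis
    have d: "in_l2 (\<lambda>x. s n x - p x)" for n using in_l2_diff[OF Pl2[OF p(2)] p(1)] .
    have "(\<lambda>n. l2_norm (\<lambda>x. u n x - a x)) \<longlonglongrightarrow> 0"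
      using l2_norm_sum_ge(1)[OF d] u(2) unfolding a_def
      by (intro Lim_null_comparison[OF _ p(3)] always_eventually) (auto simp: l2_norm_nonneg)
    moreover have "(\<lambda>n. l2_norm (\<lambda>x. J (u n) x - b x)) \<longlonglongrightarrow> 0"
      using l2_norm_sum_ge(2)[OF d] u(2) unfolding b_def
      by (intro Lim_null_comparison[OF _ p(3)] always_eventually) (auto simp: l2_norm_nonneg)
    moreover have "(u n, J (u n)) \<in> G" for n using u(1) unfolding op_graph_def by auto
    ultimately show ?thesis
      unfolding closure_op_def using ab by (auto intro!: exI[of _ "\<lambda>n. (u n, J (u n))"])
  qed
  \<comment> \<open>The projected pair belongs to the maximal operator, hence so does the residual
    \<open>(v', f')\<close>.\<close>
  then have bJ: "b = J a" using closure_op_G_le adjoint_op_G by blast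
  define v' f' where "v' x = v x - a x" and "f' x = f x - b x" for x
  have v'_eq: "v' = (\<lambda>x. v x - a x)" and f'_eq: "f' = (\<lambda>x. f x - b x)"
    by (simp_all add: fun_eq_iff v'_def f'_def)
  have l2': "in_l2 v'" "in_l2 f'" unfolding v'_def f'_def using v ab by (auto intro: in_l2_diff)
  have "f' = J v'" using J_lin[of 1 v "-1" a] v(3) bJ unfolding v'_def f'_def by (simp add: fun_eq_iff)
  \<comment> \<open>Orthogonality to \<open>(u, J u)\<close> reads
    \<open>l2_inner u v' + l2_inner (J u) f' = 0\<close>; symmetry moves \<open>J\<close> to
    \<open>f'\<close>.\<close>
  have "l2_inner u (\<lambda>x. - 1 * v' x) = l2_inner u (J f')" if u: "fin_supp u" for u
  proof -
    let ?r = "\<lambda>x. case_sum v f x - p x"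
    have r: "in_l2 ?r" using \<open>in_l2 (case_sum v f)\<close> p(1) by (rule in_l2_diff)
    have h: "case_sum u (J u) \<in> P" using u unfolding P_def by blast
    have "l2_inner u v' + l2_inner (J u) f' = 0"
      using orth[OF h] unfolding l2_inner_sum[OF Pl2[OF h] r] by (simp add: v'_eq f'_eq a_def b_def)
    then show ?thesis
      using J_symmetric[OF u, of f'] l2_inner_scale_right[of u "- 1" v'] by (simp add: add_eq_0_iff)
  qed
  then have "(\<lambda>x. - 1 * v' x) = J f'" by (rule orthogonal_fin_suppD)
  then have JJ: "J f' = (\<lambda>x. - v' x)" by simp
  \<comment> \<open>From \<open>J (J v') = - v'\<close>, applying \<open>J\<close> to
    \<open>J v' + \<i> v'\<close> multiplies it by \<open>\<i>\<close>.\<close>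
  let ?w = "\<lambda>x. f' x + \<i> * v' x"
  have "J ?w = (\<lambda>x. \<i> * ?w x)"
    using J_lin[of 1 f' \<i> v'] JJ \<open>f' = J v'\<close> by (simp add: fun_eq_iff algebra_simps)
  then have "?w = (\<lambda>x. 0)" using no_def in_l2_add(1)[OF l2'(2) in_l2_scale[OF l2'(1)]] by blast
  then have "f' x = - \<i> * v' x" for x by (simp add: fun_eq_iff add_eq_0_iff)
  \<comment> \<open>The coefficients are real, so conjugation turns the eigenvalue
    \<open>- \<i>\<close> into \<open>\<i>\<close>, to which \<open>no_def\<close> applies.\<close>
  then have "J (\<lambda>x. cnj (v' x)) = (\<lambda>x. \<i> * cnj (v' x))"
    unfolding J_cnj \<open>f' = J v'\<close>[symmetric] by simp
  then have "(\<lambda>x. cnj (v' x)) = (\<lambda>x. 0)" using no_def l2'(1) by simp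
  then have "v' = (\<lambda>x. 0)" by (simp add: fun_eq_iff)
  then have "v = a" unfolding v'_def by (simp add: fun_eq_iff)
  then show "(v, f) \<in> closure_op G" using cl bJ v(3) by simp
qed

text \<open>A symmetric operator has no nonreal eigenvalue: the pair \<open>(v, \<i> v)\<close> lies
  in the closure and in its adjoint, which gives
  \<open>- \<i> * l2_inner v v = \<i> * l2_inner v v\<close>.\<close>

lemma no_deficiency_if_ess_selfadjoint:
  assumes "ess_selfadjoint G" "in_l2 v" "J v = (\<lambda>x. \<i> * v x)"
  shows "v x = 0"
proof -
  have "(v, \<lambda>x. \<i> * v x) \<in> adjoint_op G"
    unfolding adjoint_op_G using assms in_l2_scale by auto
  moreover from this have "(v, \<lambda>x. \<i> * v x) \<in> closure_op G"
    using assms(1) ess_selfadjoint_G_iff by blast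
  moreover have "adjoint_op (closure_op G) = adjoint_op G"
    by (rule adjoint_closure_op[OF G_in_l2])
  ultimately have "l2_inner (\<lambda>x. \<i> * v x) v = l2_inner v (\<lambda>x. \<i> * v x)"
    unfolding adjoint_op_def by blast
  then have "l2_inner v v = 0"
    using l2_inner_scale_left[of \<i> v v] l2_inner_scale_right[of v \<i> v] by simp
  then show ?thesis using l2_norm_eq_0D[OF assms(2)] l2_inner_self[OF assms(2)] by simp
qed

end

section \<open>The deficiency equation on the tree\<close>

text \<open>The half-line is the case \<open>up = Suc\<close>. The vertex 0 has no child, in
  accordance with the boundary value zero at -1.\<close>

lemma jacobi_classical_eq_tree: "jacobi_classical a = jacobi_tree Suc a (\<lambda>_. 0)"
proof (intro ext)
  fix u n
  have "children Suc n = (if n = 0 then {} else {n - 1})"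
    unfolding children_def by auto
  then show "jacobi_classical a u n = jacobi_tree Suc a (\<lambda>_. 0) u n"
    unfolding jacobi_classical_def jacobi_tree_def by simp
qed

lemma finite_children_level_tree: "level_tree lev up \<Longrightarrow> finite (children up x)"
  unfolding level_tree_def by (cases "lev x = 0") auto

text \<open>For \<open>\<beta> = 0\<close> the quotients \<open>v x' / v x\<close> of a solution of \<open>J v = \<i> v\<close> lie on the positive
  imaginary axis, so all terms of the equation have the same phase.\<close>

lemma deficiency_ratio:
  assumes tree: "level_tree lev up" and lam: "\<And>x. lam x > 0"
    and eq: "jacobi_tree up lam (\<lambda>_. 0) v = (\<lambda>x. \<i> * v x)"
  shows "\<exists>r>0. v (up x) = \<i> * complex_of_real r * v x"
proof (induction "lev x" arbitrary: x rule: less_induct)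
  case less
  have "\<exists>r>0. v x = \<i> * complex_of_real r * v y" if "y \<in> children up x" for y
  proof -
    have y: "up y = x" using that unfolding children_def by simp
    then have "lev y < lev x" using tree unfolding level_tree_def by (metis less_add_one)
    from less[OF this] show ?thesis unfolding y .
  qed
  then obtain r where r: "\<And>y. y \<in> children up x \<Longrightarrow> r y > 0 \<and> v x = \<i> * complex_of_real (r y) * v y"
    by metis
  \<comment> \<open>Since the inverse of \<open>\<i>\<close> is \<open>- \<i>\<close>, every child
    term is a nonpositive multiple of \<open>\<i> * v x\<close>. Moved to the other side, these
    terms add to the 1 coming from the eigenvalue.\<close>
  define S where "S = (\<Sum>y\<in>children up x. lam y / r y)"
  have "0 \<le> S" unfolding S_def using r lam by (intro sum_nonneg) (simp add: less_imp_le)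
  have "complex_of_real (lam y) * v y = - \<i> * complex_of_real (lam y / r y) * v x"
    if "y \<in> children up x" for y
    using r[OF that] by (simp add: field_simps)
  then have "(\<Sum>y\<in>children up x. complex_of_real (lam y) * v y) = - \<i> * complex_of_real S * v x"
    unfolding S_def of_real_sum sum_distrib_left sum_distrib_right by (rule sum.cong[OF refl])
  then have "complex_of_real (lam x) * v (up x) = \<i> * complex_of_real (1 + S) * v x"
    using fun_cong[OF eq, of x] unfolding jacobi_tree_def by (simp add: algebra_simps)
  then have "v (up x) = \<i> * complex_of_real ((1 + S) / lam x) * v x"
    using lam[of x] by (simp add: field_simps)
  moreover have "0 < (1 + S) / lam x" using \<open>0 \<le> S\<close> lam[of x] by simp
  ultimately show ?case by blast
qed

text \<open>With equal phases no cancellation occurs, so the equation passes to moduli as an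
  equality.\<close>

lemma deficiency_cmod:
  assumes tree: "level_tree lev up" and lam: "\<And>x. lam x > 0"
    and eq: "jacobi_tree up lam (\<lambda>_. 0) v = (\<lambda>x. \<i> * v x)"
  shows "lam x * cmod (v (up x)) = cmod (v x) + (\<Sum>y\<in>children up x. lam y * cmod (v y))"
proof -
  obtain r where r: "\<And>x. r x > 0" "\<And>x. v (up x) = \<i> * complex_of_real (r x) * v x"
    using deficiency_ratio[OF assms] by metis
  have c: "cmod (v (up x)) = r x * cmod (v x)" for x
    using r by (simp add: norm_mult less_imp_le)
  show ?thesis
  proof (cases "v x = 0")
    case True
    \<comment> \<open>The positive ratios carry the zero at \<open>x\<close> to the children and to
      \<open>up x\<close>, so both sides vanish.\<close>
    have "cmod (v y) = 0" if "y \<in> children up x" for y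
      using c[of y] r(1)[of y] that True unfolding children_def by simp
    then show ?thesis using True c[of x] by simp
  next
    case False
    have y: "complex_of_real (lam y) * v y = - \<i> * complex_of_real (lam y / r y) * v x"
      and n: "lam y * cmod (v y) = lam y / r y * cmod (v x)"
      if "y \<in> children up x" for y
      using r[of y] c[of y] that unfolding children_def by (auto simp: field_simps)
    have "complex_of_real (lam x) * (\<i> * complex_of_real (r x) * v x)
        + - \<i> * complex_of_real (\<Sum>y\<in>children up x. lam y / r y) * v x = \<i> * v x"
      using fun_cong[OF eq, of x] y r(2)[of x] unfolding jacobi_tree_def
      by (simp add: sum_distrib_left sum_distrib_right)
    then have "\<i> * v x * complex_of_real (lam x * r x - (\<Sum>y\<in>children up x. lam y / r y) - 1) = 0"
      by (simp add: algebra_simps)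
    then have "complex_of_real (lam x * r x - (\<Sum>y\<in>children up x. lam y / r y) - 1) = 0"
      using False by simp
    then have "lam x * r x = 1 + (\<Sum>y\<in>children up x. lam y / r y)"
      by (simp only: of_real_eq_0_iff)
    then have "lam x * r x * cmod (v x) = cmod (v x) + (\<Sum>y\<in>children up x. lam y / r y * cmod (v x))"
      by (simp add: distrib_right sum_distrib_right)
    then show ?thesis using n c by simp
  qed
qed

text \<open>Nonzero ratios carry zeros up and down every edge, and any two vertices have a common
  ancestor.\<close>

lemma deficiency_nonzero:
  assumes tree: "level_tree lev up" and lam: "\<And>x. lam x > 0"
    and eq: "jacobi_tree up lam (\<lambda>_. 0) v = (\<lambda>x. \<i> * v x)"
    and "v a \<noteq> 0"
  shows "v b \<noteq> 0"
proof -
  have up: "v (up x) = 0 \<longleftrightarrow> v x = 0" for x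
    using deficiency_ratio[OF tree lam eq, of x] by auto
  have "v ((up ^^ m) x) = 0 \<longleftrightarrow> v x = 0" for m x
    by (induction m) (simp_all add: up)
  moreover obtain m n where "(up ^^ m) a = (up ^^ n) b"
    using tree unfolding level_tree_def by blast
  ultimately show ?thesis using \<open>v a \<noteq> 0\<close> by metis
qed

section \<open>The comparison solution along the path\<close>

text \<open>Moduli of the solution of the classical equation at \<open>\<i>\<close> for positive
  \<open>a\<close> and a nonnegative initial value \<open>c\<close>. The clause at
  \<open>Suc 0\<close> is the recurrence with its term at -1 set to zero.\<close>

fun path_solution :: "(nat \<Rightarrow> real) \<Rightarrow> real \<Rightarrow> nat \<Rightarrow> real" where
  "path_solution a c 0 = c"
| "path_solution a c (Suc 0) = c / a 0"
| "path_solution a c (Suc (Suc n)) = (path_solution a c (Suc n) + a n * path_solution a c n) / a (Suc n)"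

text \<open>Comparison principle: \<open>w\<close> satisfies the recurrence as an inequality. All
  coefficients are positive, so the order at two consecutive indices propagates to the next.\<close>

lemma path_solution_le:
  assumes a: "\<And>n. a n > 0" and "0 \<le> c" "c \<le> w 0" "w 0 \<le> a 0 * w (Suc 0)"
    and w: "\<And>n. w (Suc n) + a n * w n \<le> a (Suc n) * w (Suc (Suc n))"
  shows "0 \<le> path_solution a c n \<and> path_solution a c n \<le> w n"
proof (induction n rule: induct_nat_012)
  case 0
  then show ?case using assms by simp
next
  case 1
  then show ?case using assms(2-4) a[of 0] by (simp add: field_simps)
next
  case (ge2 n)
  then have "0 \<le> a n * path_solution a c n" "a n * path_solution a c n \<le> a n * w n"
    using a[of n] by (simp_all add: less_imp_le)
  then have "0 \<le> path_solution a c (Suc n) + a n * path_solution a c n"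
    "path_solution a c (Suc n) + a n * path_solution a c n \<le> a (Suc n) * w (Suc (Suc n))"
    using ge2 w[of n] by linarith+
  then show ?case using a[of "Suc n"] by (simp add: pos_divide_le_eq mult.commute)
qed

text \<open>The factor \<open>\<i> ^ n\<close> restores the phases: two steps along the path change
  the sign, turning the sum in the positive recurrence into the difference needed here.\<close>

lemma jacobi_classical_path_solution:
  fixes c :: real
  assumes "\<And>n. a n > 0"
  defines "q \<equiv> \<lambda>n. \<i> ^ n * complex_of_real (path_solution a c n)"
  shows "jacobi_classical a q = (\<lambda>n. \<i> * q n)"
proof
  fix n
  have "a 0 \<noteq> 0" "a n \<noteq> 0" using assms(1) by (simp_all add: less_imp_neq[symmetric])
  show "jacobi_classical a q n = \<i> * q n"
  proof (cases n)
    case 0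
    then show ?thesis using \<open>a 0 \<noteq> 0\<close> by (simp add: jacobi_classical_def q_def)
  next
    case (Suc m)
    have "complex_of_real (a (Suc m)) * complex_of_real (path_solution a c (Suc (Suc m)))
        = complex_of_real (path_solution a c (Suc m) + a m * path_solution a c m)"
      using \<open>a n \<noteq> 0\<close> Suc by (simp flip: of_real_mult)
    then have "\<i> ^ Suc (Suc m) * (complex_of_real (a (Suc m)) * complex_of_real (path_solution a c (Suc (Suc m))))
        = \<i> ^ Suc (Suc m) * complex_of_real (path_solution a c (Suc m) + a m * path_solution a c m)"
      by (rule arg_cong)
    then show ?thesis unfolding Suc jacobi_classical_def q_def by (simp add: algebra_simps)
  qed
qed

theorem theorem4:
  fixes lev :: "'v \<Rightarrow> nat" and up :: "'v \<Rightarrow> 'v"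
    and lam beta :: "'v \<Rightarrow> real" and xs :: "nat \<Rightarrow> 'v"
  assumes tree: "level_tree lev up"
    and lam_pos: "\<forall>x. lam x > 0"
    and beta0: "\<forall>x. beta x = 0"
    and not_esa: "\<not> ess_selfadjoint (op_graph {v. fin_supp v} (jacobi_tree up lam beta))"
    and path_lev: "\<forall>n. lev (xs n) = n"
    and path_up: "\<forall>n. up (xs n) = xs (Suc n)"
  shows "\<not> ess_selfadjoint (op_graph {u. fin_supp u} (jacobi_classical (\<lambda>n. lam (xs n))))"
proof
  assume esa: "ess_selfadjoint (op_graph {u. fin_supp u} (jacobi_classical (\<lambda>n. lam (xs n))))"
  have beta: "beta = (\<lambda>_. 0)" and lam: "\<And>x. lam x > 0" using beta0 lam_pos by auto
  obtain v where v: "in_l2 v" "jacobi_tree up lam (\<lambda>_. 0) v = (\<lambda>x. \<i> * v x)" "v \<noteq> (\<lambda>x. 0)"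
    using ess_selfadjoint_if_no_deficiency[OF finite_children_level_tree[OF tree]] not_esa
    unfolding beta by blast
  then obtain z where "v z \<noteq> 0" by auto
  \<comment> \<open>The comparison solution starts from the value at \<open>xs 0\<close>, so
    \<open>v\<close> must be nonzero exactly there.\<close>
  then have v0: "v (xs 0) \<noteq> 0" using deficiency_nonzero[OF tree lam v(2)] by blast
  define a where "a n = lam (xs n)" for n
  define q where "q n = \<i> ^ n * complex_of_real (path_solution a (cmod (v (xs 0))) n)" for n
  have rec: "lam (xs n) * cmod (v (xs (Suc n))) = cmod (v (xs n)) + (\<Sum>y\<in>children up (xs n). lam y * cmod (v y))" for n
    using deficiency_cmod[OF tree lam v(2), of "xs n"] path_up by simp
  have le: "0 \<le> path_solution a (cmod (v (xs 0))) n \<and> path_solution a (cmod (v (xs 0))) n \<le> cmod (v (xs n))" for n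
  proof (rule path_solution_le[where w = "\<lambda>n. cmod (v (xs n))"])
    show "cmod (v (xs 0)) \<le> a 0 * cmod (v (xs (Suc 0)))"
      using rec[of 0] lam unfolding a_def by (simp add: sum_nonneg less_imp_le)
    fix n
    have "xs n \<in> children up (xs (Suc n))" using path_up unfolding children_def by simp
    \<comment> \<open>Keeping only the child \<open>xs n\<close> and dropping the other nonnegative
      terms makes the moduli along the path satisfy the recurrence as an inequality.\<close>
    then have "a n * cmod (v (xs n)) \<le> (\<Sum>y\<in>children up (xs (Suc n)). lam y * cmod (v y))"
      unfolding a_def using finite_children_level_tree[OF tree] lam
      by (intro member_le_sum) (auto simp: less_imp_le)
    then show "cmod (v (xs (Suc n))) + a n * cmod (v (xs n)) \<le> a (Suc n) * cmod (v (xs (Suc (Suc n))))"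
      using rec[of "Suc n"] unfolding a_def by linarith
  qed (simp_all add: a_def lam)
  \<comment> \<open>Distinct levels give distinct vertices, so restricting \<open>v\<close> to the
    path preserves square summability.\<close>
  have "inj xs" using path_lev by (metis injI)
  have "(\<lambda>x. (cmod (v x))\<^sup>2) summable_on range xs"
    using v(1) unfolding in_l2_def by (rule summable_on_subset_banach) simp
  then have "in_l2 (\<lambda>n. v (xs n))"
    unfolding in_l2_def summable_on_reindex[OF \<open>inj xs\<close>] by (simp add: o_def)
  then have "in_l2 q"
    by (rule in_l2_comparison) (use le in \<open>simp add: q_def norm_mult norm_power\<close>)
  moreover have "jacobi_classical a q = (\<lambda>n. \<i> * q n)"
    using jacobi_classical_path_solution[of a] lam unfolding q_def a_def by simp
  moreover have "finite (children Suc n)" for n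
    by (rule finite_subset[of _ "{..n}"]) (auto simp: children_def)
  \<comment> \<open>Essential selfadjointness on the half-line excludes a nonzero \<open>q\<close>,
    whereas \<open>q 0\<close> is the modulus of \<open>v (xs 0)\<close>.\<close>
  ultimately have "q 0 = 0"
    using no_deficiency_if_ess_selfadjoint[of Suc a "\<lambda>_. 0" q] esa
    unfolding jacobi_classical_eq_tree a_def by blast
  then show False using v0 by (simp add: q_def)
qed

end
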